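(* Let $X$ and $Y$ be separable metrizable spaces and let $f : X \to Y$ be a continuous surjection that is closed--constructible, i.e. for every closed set $F \subseteq X$ the image $f(F)$ is a constructible subset of $Y$. Then $f$ is piece-wise closed: there exist closed sets $Z_1, Z_2, \ldots \subseteq X$ with $X = \bigcup_{n} Z_n$ such that for every $n$ the restriction $f|_{Z_n}$ is a closed map.
   Context: A subset $B \subseteq Y$ is constructible if it belongs to the smallest family of subsets of $Y$ that contains all open sets and is stable under finite intersections and complements (equivalently, $B$ is a finite union of locally closed sets, a locally closed set being the intersection of an open set and a closed set). A function $f: X \to Y$ is closed--constructible if it takes closed subsets of $X$ to constructible subsets of $Y$. A function $f : X \to Y$ is piece-wise closed if $X$ can be written as a countable union of closed sets $Z_n$ such that $f$ is closed on every $Z_n$ (i.e. $f|_{Z_n}$ maps closed subsets of $Z_n$ to closed subsets of $Y$). *)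

theory Defs
  imports "HOL-Analysis.Analysis"
begin

inductive constructible_in :: "'a topology \<Rightarrow> 'a set \<Rightarrow> bool" for Y where
  open_constructible: "openin Y U \<Longrightarrow> constructible_in Y U"
| inter_constructible: "constructible_in Y A \<Longrightarrow> constructible_in Y B \<Longrightarrow> constructible_in Y (A \<inter> B)"
| compl_constructible: "constructible_in Y A \<Longrightarrow> constructible_in Y (topspace Y - A)"

definition closed_constructible :: "'a topology \<Rightarrow> 'b topology \<Rightarrow> ('a \<Rightarrow> 'b) \<Rightarrow> bool" where
  "closed_constructible X Y f \<longleftrightarrow> (\<forall>F. closedin X F \<longrightarrow> constructible_in Y (f ` F))"

definition piecewise_closed :: "'a topology \<Rightarrow> 'b topology \<Rightarrow> ('a \<Rightarrow> 'b) \<Rightarrow> bool" where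
  "piecewise_closed X Y f \<longleftrightarrow>
     (\<exists>Z :: nat \<Rightarrow> 'a set. (\<forall>n. closedin X (Z n)) \<and> (\<Union>n. Z n) = topspace X \<and>
        (\<forall>n. closed_map (subtopology X (Z n)) Y f))"

end

theory Submission
  imports Defs
begin

text \<open>
  By the Lindelof property there is a largest open set on which \<open>f\<close> is piece-wise closed. Replacing
  \<open>X\<close> by its complement, suppose that \<open>X\<close> is nonempty and that \<open>f\<close> is piece-wise closed on no
  nonempty open set; we construct a closed set with a non-constructible image.

  For \<open>A \<subseteq> Y\<close> put \<open>R\<^sub>0 = A\<close> and \<open>R\<^sub>n\<^sub>+\<^sub>1 = A \<inter> cl (cl R\<^sub>n - A)\<close>. If \<open>A\<close> is a Boolean combination of \<open>k\<close>
  open sets, then each step from a point of \<open>A\<close> to a nearby point outside \<open>A\<close> strictly enlarges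
  the collection of those open sets containing the point, so \<open>R\<^sub>n\<close> is empty for \<open>n > k\<close>.

  On the other hand, every nonempty open \<open>U\<close> contains a closed \<open>F\<close> such that \<open>f F\<close> has a nonempty
  \<open>R\<^sub>n\<close>. To pass from \<open>n\<close> to \<open>n + 1\<close>, note that \<open>f\<close> fails to be closed inside every nonempty open
  set, which gives a point \<open>y\<close> of the image and open sets \<open>W\<^sub>i\<close> forming a locally finite family
  whose images converge to \<open>y\<close>; sets \<open>F\<^sub>i \<subseteq> W\<^sub>i\<close> for \<open>n\<close> put \<open>y\<close> into \<open>cl R\<^sub>n\<close>. Doing this in a
  sequence of open sets shrinking to a point \<open>x\<close> puts \<open>f x\<close> into \<open>R\<^sub>n\<^sub>+\<^sub>1\<close>. The pieces do not interfere,
  since all the sets in \<open>Y\<close> involved are countable and closed and the preimage of such a set has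
  empty interior. Gluing pieces for all \<open>n\<close> along one more locally finite family gives the
  required closed set.
\<close>

section \<open>Alternation of constructible sets\<close>

text \<open>These are the iterated Hausdorff residues of \<open>A\<close>: within \<open>A\<close>,
  the closure of the n-th set adds no points to it, so removing \<open>A\<close> from that closure
  is the same as removing the n-th set.\<close>

primrec alternation :: "'b topology \<Rightarrow> 'b set \<Rightarrow> nat \<Rightarrow> 'b set" where
  "alternation Y A 0 = A"
| "alternation Y A (Suc n) = A \<inter> Y closure_of (Y closure_of (alternation Y A n) - A)"

text \<open>A semantic substitute for being a Boolean combination of members of \<U>, which avoids a
  syntax of Boolean terms.\<close>

definition determined_by :: "'b topology \<Rightarrow> 'b set set \<Rightarrow> 'b set \<Rightarrow> bool" where
  "determined_by Y \<U> A \<longleftrightarrow>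
    (\<forall>p\<in>topspace Y. \<forall>q\<in>topspace Y. (\<forall>U\<in>\<U>. p \<in> U \<longleftrightarrow> q \<in> U) \<longrightarrow> (p \<in> A \<longleftrightarrow> q \<in> A))"

lemma determined_by_Int:
  assumes "determined_by Y \<U> A" "determined_by Y \<V> B"
  shows "determined_by Y (\<U> \<union> \<V>) (A \<inter> B)"
  unfolding determined_by_def
proof (intro ballI impI)
  fix p q assume pq: "p \<in> topspace Y" "q \<in> topspace Y" "\<forall>U\<in>\<U> \<union> \<V>. p \<in> U \<longleftrightarrow> q \<in> U"
  have "p \<in> A \<longleftrightarrow> q \<in> A" using assms(1) pq unfolding determined_by_def by (meson UnI1)
  moreover have "p \<in> B \<longleftrightarrow> q \<in> B" using assms(2) pq unfolding determined_by_def by (meson UnI2)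
  ultimately show "p \<in> A \<inter> B \<longleftrightarrow> q \<in> A \<inter> B" by simp
qed

lemma determined_by_compl:
  "determined_by Y \<U> A \<Longrightarrow> determined_by Y \<U> (topspace Y - A)"
  unfolding determined_by_def by (metis Diff_iff)

lemma constructible_in_imp_determined_by:
  assumes "constructible_in Y A"
  shows "\<exists>\<U>. finite \<U> \<and> \<U> \<subseteq> Collect (openin Y) \<and> determined_by Y \<U> A"
  using assms
proof (induction rule: constructible_in.induct)
  case (open_constructible U)
  then show ?case by (intro exI[of _ "{U}"]) (auto simp: determined_by_def)
next
  case (inter_constructible A B)
  obtain \<U> where "finite \<U>" "\<U> \<subseteq> Collect (openin Y)" "determined_by Y \<U> A"
    using inter_constructible.IH(1) by blast
  moreover obtain \<V> where "finite \<V>" "\<V> \<subseteq> Collect (openin Y)" "determined_by Y \<V> B"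
    using inter_constructible.IH(2) by blast
  ultimately show ?case
    by (intro exI[of _ "\<U> \<union> \<V>"]) (simp add: determined_by_Int)
next
  case (compl_constructible A)
  then show ?case using determined_by_compl by blast
qed

lemma constructible_in_alternation_empty:
  assumes "constructible_in Y A"
  obtains n where "alternation Y A n = {}"
proof -
  obtain \<U> where \<U>: "finite \<U>" "\<U> \<subseteq> Collect (openin Y)" "determined_by Y \<U> A"
    using constructible_in_imp_determined_by[OF assms] by blast
  note fin = \<U>(1)
  have opn: "openin Y U" if "U \<in> \<U>" for U
    using \<U>(2) that by blast
  define t where "t p = {U \<in> \<U>. p \<in> U}" for p
  have fint: "finite (t p)" for p
    using fin by (simp add: t_def)
  \<comment> \<open>The finitely many members of \<U> around \<open>p\<close> intersect in a
    neighbourhood of \<open>p\<close>, and any point of \<open>S\<close> in it lies in all of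
    them.\<close>
  have near: "\<exists>q\<in>S. t p \<subseteq> t q" if p: "p \<in> Y closure_of S" for p S
  proof -
    have "openin Y (topspace Y \<inter> \<Inter>(t p))"
      using fint opn by (intro openin_Int_Inter) (auto simp: t_def)
    moreover have "p \<in> topspace Y \<inter> \<Inter>(t p)"
      using p by (auto simp: t_def in_closure_of)
    ultimately obtain q where "q \<in> S" "q \<in> \<Inter>(t p)"
      using p unfolding in_closure_of by blast
    then show ?thesis
      by (intro bexI[of _ q]) (auto simp: t_def)
  qed
  have bound: "card (t p) + n \<le> card \<U>" if "p \<in> alternation Y A n" for p n
    using that
  proof (induction n arbitrary: p)
    case 0
    then show ?case using fin by (auto simp: t_def intro!: card_mono)
  next
    case (Suc n)
    then have "p \<in> Y closure_of (Y closure_of (alternation Y A n) - A)" by simp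
    then obtain q where q: "q \<in> Y closure_of (alternation Y A n)" "q \<notin> A" "t p \<subseteq> t q"
      using near by blast
    then obtain r where r: "r \<in> alternation Y A n" "t q \<subseteq> t r"
      using near by blast
    \<comment> \<open>\<open>A\<close> contains \<open>p\<close> but not \<open>q\<close>, so some
      member of \<U> separates them and the first of the inclusions
      \<open>t p \<subseteq> t q \<subseteq> t r\<close> is strict.\<close>
    have "p \<in> A" "p \<in> topspace Y" "q \<in> topspace Y"
      using Suc.prems q by (auto simp: in_closure_of)
    then have "\<not> (\<forall>U\<in>\<U>. p \<in> U \<longleftrightarrow> q \<in> U)"
      using \<U>(3) q(2) unfolding determined_by_def by metis
    then have "t p \<noteq> t q" unfolding t_def by blast
    then have "card (t p) < card (t r)"
      using q r fint by (intro psubset_card_mono) auto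
    then show ?case using Suc.IH[OF r(1)] by simp
  qed
  have "alternation Y A (Suc (card \<U>)) = {}"
    using bound[of _ "Suc (card \<U>)"] by fastforce
  then show ?thesis using that by blast
qed

section \<open>Topological preliminaries\<close>

lemma metrizable_separable_imp_second_countable:
  assumes "metrizable_space X" "separable_space X"
  shows "second_countable X"
proof -
  obtain M d where M: "Metric_space M d" and X: "X = Metric_space.mtopology M d"
    using assms(1) by (auto simp: metrizable_space_def)
  interpret Metric_space M d by (rule M)
  obtain C where C: "countable C" "C \<subseteq> M" "mtopology closure_of C = M"
    using assms(2) by (auto simp: separable_space_def X)
  let ?B = "(\<lambda>(c, n::nat). mball c (1 / Suc n)) ` (C \<times> UNIV)"
  have "\<exists>V\<in>?B. x \<in> V \<and> V \<subseteq> U" if U: "openin mtopology U" "x \<in> U" for U x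
  proof -
    have xM: "x \<in> M" using openin_subset[OF U(1)] U(2) by auto
    obtain r where r: "r > 0" "mball x r \<subseteq> U"
      using U by (auto simp: openin_mtopology)
    obtain n :: nat where n: "1 / Suc n < r / 2"
      using r(1) nat_approx_posE[of "r/2"] by auto
    have "x \<in> mtopology closure_of C" using C xM by simp
    then obtain c where c: "c \<in> C" "d x c < 1 / Suc n"
      using openin_mball[of x "1 / Suc n"] xM unfolding in_closure_of
      by (metis centre_in_mball_iff in_mball of_nat_0_less_iff zero_less_Suc zero_less_divide_1_iff)
    have "x \<in> mball c (1 / Suc n)"
      using c C xM by (auto simp: commute)
    moreover have "mball c (1 / Suc n) \<subseteq> U"
    proof
      fix z assume z: "z \<in> mball c (1 / Suc n)"
      then have "d x z \<le> d x c + d c z" using xM by (intro triangle) auto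
      then have "d x z < r" using z c n by auto
      then show "z \<in> U" using r z xM by auto
    qed
    ultimately show ?thesis using c by blast
  qed
  moreover have "countable ?B" using C by auto
  moreover have "\<forall>V\<in>?B. openin mtopology V" by auto
  ultimately show ?thesis
    unfolding second_countable_def X by blast
qed

text \<open>Convergence of sets to a point; the sets need be neither nested nor contain
  \<open>y\<close>.\<close>

definition shrinks_to :: "'b topology \<Rightarrow> (nat \<Rightarrow> 'b set) \<Rightarrow> 'b \<Rightarrow> bool" where
  "shrinks_to Y S y \<longleftrightarrow> (\<forall>N. openin Y N \<longrightarrow> y \<in> N \<longrightarrow> (\<exists>n. \<forall>i\<ge>n. S i \<subseteq> N))"

lemma shrinks_toD:
  "shrinks_to Y S y \<Longrightarrow> openin Y N \<Longrightarrow> y \<in> N \<Longrightarrow> \<exists>n. \<forall>i\<ge>n. S i \<subseteq> N"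
  by (simp add: shrinks_to_def)

lemma shrinks_toE:
  assumes "shrinks_to Y S y" "openin Y N" "y \<in> N"
  obtains i where "S i \<subseteq> N"
  using shrinks_toD[OF assms] by (meson order_refl)

lemma shrinks_to_subset:
  assumes "shrinks_to Y S y" "\<And>i. T i \<subseteq> S i"
  shows "shrinks_to Y T y"
  using assms unfolding shrinks_to_def by (meson order_trans)

lemma shrinks_to_image:
  assumes "shrinks_to X S x" "continuous_map X Y f" "x \<in> topspace X"
  shows "shrinks_to Y (\<lambda>i. f ` S i) (f x)"
  unfolding shrinks_to_def
proof (intro allI impI)
  fix N assume N: "openin Y N" "f x \<in> N"
  then obtain n where "\<forall>i\<ge>n. S i \<subseteq> {x \<in> topspace X. f x \<in> N}"
    using shrinks_toD[OF assms(1) openin_continuous_map_preimage[OF assms(2) N(1)]] assms(3) by auto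
  then show "\<exists>n. \<forall>i\<ge>n. f ` S i \<subseteq> N" by (intro exI[of _ n]) auto
qed

lemma metrizable_decreasing_neighbourhood_base:
  assumes "metrizable_space Y" "y \<in> topspace Y"
  obtains B :: "nat \<Rightarrow> 'b set" where "\<And>n. openin Y (B n)" "\<And>n. y \<in> B n"
    "shrinks_to Y B y"
proof -
  obtain M d where M: "Metric_space M d" and Y: "Y = Metric_space.mtopology M d"
    using assms(1) by (auto simp: metrizable_space_def)
  interpret Metric_space M d by (rule M)
  have yM: "y \<in> M" using assms(2) by (simp add: Y)
  have "shrinks_to Y (\<lambda>n. mball y (1 / Suc n)) y"
    unfolding shrinks_to_def
  proof (intro allI impI)
    fix N assume "openin Y N" "y \<in> N"
    then obtain r where r: "r > 0" "mball y r \<subseteq> N"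
      by (auto simp: Y openin_mtopology)
    obtain n :: nat where n: "1 / Suc n < r"
      using r(1) nat_approx_posE by blast
    have "mball y (1 / Suc m) \<subseteq> N" if "m \<ge> n" for m
    proof -
      have "1 / Suc m \<le> 1 / Suc n" using that by (simp add: frac_le)
      then have "mball y (1 / Suc m) \<subseteq> mball y r"
        using n by (intro mball_subset_concentric) linarith
      with r show ?thesis by blast
    qed
    then show "\<exists>n. \<forall>m\<ge>n. mball y (1 / Suc m) \<subseteq> N" by blast
  qed
  then show ?thesis
    using that[of "\<lambda>n. mball y (1 / Suc n)"] yM by (simp add: Y)
qed

text \<open>A point other than \<open>y\<close> has a neighbourhood disjoint from some neighbourhood
  of \<open>y\<close>, hence from all but finitely many \<open>E i\<close>; the remaining ones are
  closed and can be subtracted.\<close>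

lemma closedin_insert_Union_converging:
  fixes E :: "nat \<Rightarrow> 'b set"
  assumes "Hausdorff_space Y" "y \<in> topspace Y" "\<And>i. closedin Y (E i)"
    and conv: "shrinks_to Y E y"
  shows "closedin Y (insert y (\<Union>i. E i))"
  unfolding closedin_def
proof (intro conjI)
  show "insert y (\<Union>i. E i) \<subseteq> topspace Y"
    using assms(2,3) closedin_subset by fastforce
  show "openin Y (topspace Y - insert y (\<Union>i. E i))"
  proof (subst openin_subopen, intro ballI)
    fix p assume p: "p \<in> topspace Y - insert y (\<Union>i. E i)"
    then have "p \<in> topspace Y" "p \<noteq> y" by auto
    then obtain N M where NM: "openin Y N" "openin Y M" "p \<in> N" "y \<in> M" "disjnt N M"
      using assms(1,2) unfolding Hausdorff_space_def by blast
    then obtain n where n: "\<And>i. i \<ge> n \<Longrightarrow> E i \<subseteq> M"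
      using shrinks_toD[OF conv NM(2,4)] by blast
    have "openin Y (N - (\<Union>i\<in>{..<n}. E i))"
      using NM assms(3) by (intro openin_diff closedin_Union) auto
    moreover have "p \<in> N - (\<Union>i\<in>{..<n}. E i)" using p NM by auto
    moreover have "N - (\<Union>i\<in>{..<n}. E i) \<subseteq> topspace Y - insert y (\<Union>i. E i)"
    proof
      fix q assume q: "q \<in> N - (\<Union>i\<in>{..<n}. E i)"
      have "q \<notin> M" using q NM by (auto simp: disjnt_iff)
      then have "q \<notin> E i" for i using n[of i] q by (cases "i < n") auto
      then show "q \<in> topspace Y - insert y (\<Union>i. E i)"
        using q NM openin_subset[OF NM(1)] \<open>q \<notin> M\<close> by auto
    qed
    ultimately show "\<exists>T. openin Y T \<and> p \<in> T \<and> T \<subseteq> topspace Y - insert y (\<Union>i. E i)"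
      by blast
  qed
qed

lemma constructible_in_imp_fsigma_in:
  assumes "metrizable_space Y" "constructible_in Y A"
  shows "fsigma_in Y A"
proof -
  \<comment> \<open>Complements exchange the two properties, so the induction must carry
    both.\<close>
  have "fsigma_in Y A \<and> gdelta_in Y A"
    using assms(2)
  proof (induction rule: constructible_in.induct)
    case (open_constructible U)
    then show ?case using assms(1) open_imp_fsigma_in open_imp_gdelta_in by blast
  next
    case (inter_constructible A B)
    then show ?case by (simp add: fsigma_in_Int gdelta_in_Int)
  next
    case (compl_constructible A)
    then show ?case by (simp add: fsigma_in_diff gdelta_in_diff)
  qed
  then show ?thesis ..
qed

section \<open>Sets on which a map is piece-wise closed\<close>

text \<open>The pieces are closed in all of \<open>X\<close>, not just in the set they cover, so
  countable unions of such sets are again of this kind, and open sets can be treated like closed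
  ones.\<close>

definition piecewise_closed_on :: "'a topology \<Rightarrow> 'b topology \<Rightarrow> ('a \<Rightarrow> 'b) \<Rightarrow> 'a set \<Rightarrow> bool" where
  "piecewise_closed_on X Y f =
    countable union_of (\<lambda>Z. closedin X Z \<and> closed_map (subtopology X Z) Y f)"

lemma piecewise_closed_on_topspace:
  "piecewise_closed_on X Y f (topspace X) \<longleftrightarrow> piecewise_closed X Y f"
proof -
  \<comment> \<open>With the empty piece available, every countable family can be enumerated by
    \<open>nat\<close>.\<close>
  have "closedin X {} \<and> closed_map (subtopology X {}) Y f"
    by (auto simp: closed_map_def)
  then show ?thesis
    unfolding piecewise_closed_on_def piecewise_closed_def
    by (subst countable_union_of_explicit) (simp_all add: all_conj_distrib conj_ac)
qed

lemma piecewise_closed_on_piece: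
  assumes "closedin X Z" "closed_map (subtopology X Z) Y f"
  shows "piecewise_closed_on X Y f Z"
  unfolding piecewise_closed_on_def using assms by (intro countable_union_of_inc) simp

lemma piecewise_closed_on_Union:
  assumes "countable \<S>" "\<And>S. S \<in> \<S> \<Longrightarrow> piecewise_closed_on X Y f S"
  shows "piecewise_closed_on X Y f (\<Union>\<S>)"
  using assms unfolding piecewise_closed_on_def by (rule countable_union_of_Union)

lemma piecewise_closed_on_Un:
  assumes "piecewise_closed_on X Y f S" "piecewise_closed_on X Y f T"
  shows "piecewise_closed_on X Y f (S \<union> T)"
  using piecewise_closed_on_Union[of "{S, T}" X Y f] assms by auto

lemma piecewise_closed_on_subtopologyD:
  assumes "piecewise_closed_on (subtopology X T) Y f S" "closedin X T"
  shows "piecewise_closed_on X Y f S"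
  using assms(1) unfolding piecewise_closed_on_def
proof (rule union_of_mono)
  fix Z
  assume Z: "closedin (subtopology X T) Z \<and> closed_map (subtopology (subtopology X T) Z) Y f"
  then have "closedin X Z" "Z \<subseteq> T"
    using assms(2) closedin_closed_subtopology by blast+
  then show "closedin X Z \<and> closed_map (subtopology X Z) Y f"
    using Z by (simp add: subtopology_subtopology inf.absorb2)
qed

text \<open>If \<open>f\<close> is closed as a map onto \<open>f\<close>
  K\<open>, only limits outside\<close>f \<open>K\<close> can spoil closedness. Write the image as a
  union of closed sets \<open>C n\<close>: over each \<open>C n\<close>, limits stay in
  \<open>C n\<close> and hence in the image.\<close>

lemma piecewise_closed_on_closed:
  fixes X :: "'a topology" and Y :: "'b topology"
  assumes "metrizable_space Y" "continuous_map X Y f" "closedin X K" "constructible_in Y (f ` K)"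
    and closed_rel: "\<And>H. closedin X H \<Longrightarrow> H \<subseteq> K \<Longrightarrow> f ` K \<inter> Y closure_of (f ` H) \<subseteq> f ` H"
  shows "piecewise_closed_on X Y f K"
proof -
  obtain C :: "nat \<Rightarrow> 'b set" where C: "\<And>n. closedin Y (C n)" "(\<Union>n. C n) = f ` K"
    using constructible_in_imp_fsigma_in[OF assms(1,4)] unfolding fsigma_in_ascending by metis
  define Z where "Z n = K \<inter> {x \<in> topspace X. f x \<in> C n}" for n
  have cl: "closedin X (Z n)" for n
    unfolding Z_def using assms(2,3) C(1) by (intro closedin_Int closedin_continuous_map_preimage)
  have "closed_map (subtopology X (Z n)) Y f" for n
    unfolding closed_map_def
  proof (intro allI impI)
    fix H assume "closedin (subtopology X (Z n)) H"
    then have H: "closedin X H" "H \<subseteq> Z n"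
      using closedin_closed_subtopology cl by blast+
    have sub: "f ` H \<subseteq> C n" "C n \<subseteq> f ` K" "H \<subseteq> K" using H C(2) by (auto simp: Z_def)
    then have "Y closure_of (f ` H) \<subseteq> C n"
      using C(1) by (simp add: closure_of_minimal)
    then have "Y closure_of (f ` H) \<subseteq> f ` H"
      using closed_rel[OF H(1) sub(3)] sub(2) by (meson Int_greatest order_refl order_trans)
    moreover have "f ` H \<subseteq> topspace Y"
      using sub(1) closedin_subset[OF C(1)] by blast
    ultimately show "closedin Y (f ` H)"
      by (metis closure_of_subset closedin_closure_of subset_antisym)
  qed
  then have "piecewise_closed_on X Y f (\<Union>(range Z))"
    using cl by (intro piecewise_closed_on_Union) (auto intro: piecewise_closed_on_piece)
  moreover have "\<Union>(range Z) = K"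
  proof
    show "K \<subseteq> \<Union>(range Z)"
    proof
      fix x assume "x \<in> K"
      moreover then have "f x \<in> (\<Union>n. C n)" "x \<in> topspace X"
        using C(2) closedin_subset[OF assms(3)] by auto
      ultimately show "x \<in> \<Union>(range Z)" by (auto simp: Z_def)
    qed
  qed (auto simp: Z_def)
  ultimately show ?thesis by simp
qed

section \<open>Maps that are nowhere piece-wise closed\<close>

text \<open>The empty space is allowed; the locale ends by showing that it is the only
  instance.\<close>

locale nowhere_piecewise_closed =
  fixes X :: "'a topology" and Y :: "'b topology" and f :: "'a \<Rightarrow> 'b"
  assumes metrX: "metrizable_space X" and metrY: "metrizable_space Y"
    and cont: "continuous_map X Y f"
    and constr: "closed_constructible X Y f"
    and nowhere: "\<And>W. openin X W \<Longrightarrow> W \<noteq> {} \<Longrightarrow> \<not> piecewise_closed_on X Y f W"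
begin

lemma HausdorffY: "Hausdorff_space Y"
  using metrY by (rule metrizable_imp_Hausdorff_space)

lemma f_in: "x \<in> topspace X \<Longrightarrow> f x \<in> topspace Y"
  using cont by (auto simp: continuous_map_def)

lemma closedin_fibre: "y \<in> topspace Y \<Longrightarrow> closedin X {x \<in> topspace X. f x = y}"
  using closedin_continuous_map_preimage[OF cont, of "{y}"] HausdorffY
  by (simp add: closedin_Hausdorff_singleton)

lemma open_decompose:
  assumes "openin X W"
  obtains K :: "nat \<Rightarrow> 'a set" where "\<And>n. closedin X (K n)" "(\<Union>n. K n) = W"
  using open_imp_fsigma_in[OF metrX assms] unfolding fsigma_in_ascending by metis

text \<open>Otherwise \<open>W\<close> would be a countable union of closed sets each mapped into a
  single point, and \<open>f\<close> is trivially closed on these. Thus a countable closed set of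
  values can be avoided inside any nonempty open set.\<close>

lemma open_diff_preimage_nonempty:
  assumes W: "openin X W" "W \<noteq> {}" and C: "closedin Y C" "countable C"
  shows "openin X (W - {x \<in> topspace X. f x \<in> C})" "W - {x \<in> topspace X. f x \<in> C} \<noteq> {}"
proof -
  show "openin X (W - {x \<in> topspace X. f x \<in> C})"
    using W C closedin_continuous_map_preimage[OF cont] by blast
  show "W - {x \<in> topspace X. f x \<in> C} \<noteq> {}"
  proof
    assume sub: "W - {x \<in> topspace X. f x \<in> C} = {}"
    obtain K :: "nat \<Rightarrow> 'a set" where K: "\<And>n. closedin X (K n)" "(\<Union>n. K n) = W"
      using open_decompose[OF W(1)] by metis
    define Z where "Z n c = K n \<inter> {x \<in> topspace X. f x = c}" for n c
    have "piecewise_closed_on X Y f (Z n c)" if "c \<in> C" for n c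
    proof (rule piecewise_closed_on_piece)
      have c: "c \<in> topspace Y" using C that closedin_subset by blast
      then show "closedin X (Z n c)"
        unfolding Z_def using K(1) closedin_fibre by blast
      show "closed_map (subtopology X (Z n c)) Y f"
        unfolding closed_map_def
      proof (intro allI impI)
        fix H assume "closedin (subtopology X (Z n c)) H"
        then have "H \<subseteq> Z n c" using closedin_subset by fastforce
        then have "f ` H = {} \<or> f ` H = {c}" by (auto simp: Z_def)
        then show "closedin Y (f ` H)"
          using c HausdorffY by (auto simp: closedin_Hausdorff_singleton)
      qed
    qed
    then have "piecewise_closed_on X Y f (\<Union>((\<lambda>(n, c). Z n c) ` (UNIV \<times> C)))"
      using C(2) by (intro piecewise_closed_on_Union) auto
    moreover have "\<Union>((\<lambda>(n, c). Z n c) ` (UNIV \<times> C)) = W"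
      using sub K(2) by (auto simp: Z_def)
    ultimately have "piecewise_closed_on X Y f W" by simp
    then show False using nowhere W by blast
  qed
qed

lemma obtain_nonclosed_image:
  assumes "openin X V" "V \<noteq> {}"
  obtains H y where "closedin X H" "H \<subseteq> V" "y \<in> f ` V" "y \<in> Y closure_of (f ` H)" "y \<notin> f ` H"
proof -
  obtain K :: "nat \<Rightarrow> 'a set" where K: "\<And>n. closedin X (K n)" "(\<Union>n. K n) = V"
    using open_decompose[OF assms(1)] by metis
  obtain n where n: "\<not> piecewise_closed_on X Y f (K n)"
    using piecewise_closed_on_Union[of "range K" X Y f] K(2) nowhere[OF assms] by auto
  have "constructible_in Y (f ` K n)"
    using constr K(1) by (simp add: closed_constructible_def)
  then obtain H where "closedin X H" "H \<subseteq> K n" "\<not> f ` K n \<inter> Y closure_of (f ` H) \<subseteq> f ` H"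
    using piecewise_closed_on_closed[OF metrY cont K(1)] n by metis
  then show ?thesis using that K(2) by blast
qed

text \<open>
  Points of the fibre over \<open>y\<close> are separated from all \<open>W i\<close> by normality, the other points from all
  but finitely many \<open>W i\<close> because the images converge to \<open>y\<close>.
\<close>

lemma obtain_locally_finite_converging:
  assumes V: "openin X V" "V \<noteq> {}"
  obtains y and W :: "nat \<Rightarrow> 'a set" where "y \<in> f ` V"
    "\<And>i. openin X (W i)" "\<And>i. W i \<noteq> {}" "\<And>i. W i \<subseteq> V"
    "shrinks_to Y (\<lambda>i. f ` W i) y"
    "\<And>F. (\<And>i. closedin X (F i)) \<Longrightarrow> (\<And>i. F i \<subseteq> W i) \<Longrightarrow> closedin X (\<Union>i. F i)"
proof -
  obtain H y where H: "closedin X H" "H \<subseteq> V" "y \<in> f ` V" "y \<in> Y closure_of (f ` H)" "y \<notin> f ` H"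
    by (rule obtain_nonclosed_image[OF V])
  have y: "y \<in> topspace Y" using H(4) by (simp add: in_closure_of)
  let ?P = "{x \<in> topspace X. f x = y}"
  have "disjnt ?P H" using H(5) by (auto simp: disjnt_iff)
  then obtain N N' where N: "openin X N" "openin X N'" "?P \<subseteq> N" "H \<subseteq> N'" "disjnt N N'"
    using metrizable_imp_normal_space[OF metrX, unfolded normal_space_def, rule_format, of ?P H]
      closedin_fibre[OF y] H(1) by blast
  obtain B :: "nat \<Rightarrow> 'b set" where B: "\<And>n. openin Y (B n)" "\<And>n. y \<in> B n"
    "shrinks_to Y B y"
    by (rule metrizable_decreasing_neighbourhood_base[OF metrY y]) (rule that; iprover)
  \<comment> \<open>\<open>N'\<close> keeps \<open>W i\<close> off the fibre over \<open>y\<close>,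
    \<open>B i\<close> makes the images converge, and points of \<open>H\<close> keep
    \<open>W i\<close> nonempty.\<close>
  define W where "W i = N' \<inter> V \<inter> {x \<in> topspace X. f x \<in> B i}" for i
  have conv: "shrinks_to Y (\<lambda>i. f ` W i) y"
    by (rule shrinks_to_subset[OF B(3)]) (auto simp: W_def)
  show ?thesis
  proof
    show "y \<in> f ` V" by (rule H(3))
    show "openin X (W i)" for i
      unfolding W_def using N(2) V(1) openin_continuous_map_preimage[OF cont B(1)]
      by (intro openin_Int) auto
    show "W i \<noteq> {}" for i
    proof -
      obtain h where "h \<in> H" "f h \<in> B i"
        using H(4) B(1,2)[of i] by (auto simp: in_closure_of)
      then have "h \<in> W i" using H N closedin_subset[OF H(1)] by (auto simp: W_def)
      then show ?thesis by blast
    qed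
    show "W i \<subseteq> V" for i by (auto simp: W_def)
    show "shrinks_to Y (\<lambda>i. f ` W i) y" by (rule conv)
    show "closedin X (\<Union>i. F i)" if F: "\<And>i. closedin X (F i)" "\<And>i. F i \<subseteq> W i" for F :: "nat \<Rightarrow> 'a set"
    proof (rule closedin_locally_finite_Union)
      show "closedin X S" if "S \<in> range F" for S using that F(1) by blast
      have "\<exists>M. openin X M \<and> x \<in> M \<and> finite {U \<in> range F. U \<inter> M \<noteq> {}}" if x: "x \<in> topspace X" for x
      proof (cases "f x = y")
        case True
        have "W i \<inter> N = {}" for i using N(5) by (auto simp: W_def disjnt_iff)
        then have "{U \<in> range F. U \<inter> N \<noteq> {}} = {}" using F(2) by blast
        then show ?thesis using N(1,3) x True by (metis (mono_tags, lifting) finite.emptyI mem_Collect_eq subsetD)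
      next
        case False
        then obtain M M' where M: "openin Y M" "openin Y M'" "f x \<in> M" "y \<in> M'" "disjnt M M'"
          using HausdorffY f_in[OF x] y unfolding Hausdorff_space_def by blast
        obtain n where n: "\<forall>i\<ge>n. f ` W i \<subseteq> M'" using shrinks_toD[OF conv M(2,4)] by blast
        let ?M = "{x \<in> topspace X. f x \<in> M}"
        have "i < n" if "F i \<inter> ?M \<noteq> {}" for i
        proof (rule ccontr)
          assume "\<not> i < n"
          then have "f ` F i \<subseteq> M'" using n F(2)[of i] by (meson image_mono not_less order_trans)
          then show False using that M(5) by (auto simp: disjnt_iff)
        qed
        then have "{U \<in> range F. U \<inter> ?M \<noteq> {}} \<subseteq> F ` {..<n}" by auto
        then have "finite {U \<in> range F. U \<inter> ?M \<noteq> {}}" by (rule finite_subset) simp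
        then show ?thesis
          using openin_continuous_map_preimage[OF cont M(1)] x M(3)
          by (intro exI[of _ ?M]) auto
      qed
      moreover have "\<Union>(range F) \<subseteq> topspace X"
        using F(1) closedin_subset by blast
      ultimately show "locally_finite_in X (range F)"
        by (auto simp: locally_finite_in_def)
    qed
  qed
qed

text \<open>
  The countable closed set \<open>E\<close> isolates \<open>f ` F\<close> from the other pieces of a larger image: the
  properties of \<open>f ` F\<close> needed below are those shared by all sets \<open>A\<close> with \<open>A \<inter> E = f ` F\<close>.
\<close>

definition isolated_piece :: "'a set \<Rightarrow> 'a set \<Rightarrow> 'b set \<Rightarrow> bool" where
  "isolated_piece U F E \<longleftrightarrow>
    closedin X F \<and> F \<subseteq> U \<and> closedin Y E \<and> countable E \<and> f ` F \<subseteq> E \<and> E \<subseteq> f ` U"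

text \<open>Realizability in every nonempty open set is what the induction needs, since pieces are
  placed in open sets prescribed by earlier choices.\<close>

definition abundant :: "('a set \<Rightarrow> 'b set \<Rightarrow> bool) \<Rightarrow> bool" where
  "abundant Q \<longleftrightarrow> (\<forall>U. openin X U \<longrightarrow> U \<noteq> {} \<longrightarrow> (\<exists>F E. isolated_piece U F E \<and> Q F E))"

lemma abundantI:
  assumes "\<And>U. openin X U \<Longrightarrow> U \<noteq> {} \<Longrightarrow> \<exists>F E. isolated_piece U F E \<and> Q F E"
  shows "abundant Q"
  using assms by (simp add: abundant_def)

lemma abundantD:
  "abundant Q \<Longrightarrow> openin X U \<Longrightarrow> U \<noteq> {} \<Longrightarrow> \<exists>F E. isolated_piece U F E \<and> Q F E"
  by (simp add: abundant_def)

text \<open>The pieces are chosen one after another, each off the preimage of all values used so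
  far. The property \<open>Q i\<close> may vary with \<open>i\<close>, as the final gluing
  requires.\<close>

lemma obtain_disjoint_pieces:
  fixes W :: "nat \<Rightarrow> 'a set"
  assumes W: "\<And>i. openin X (W i)" "\<And>i. W i \<noteq> {}"
    and Q: "\<And>i. abundant (Q i)"
    and y: "y \<in> topspace Y"
    and conv: "shrinks_to Y (\<lambda>i. f ` W i) y"
  obtains F E where "\<And>i. isolated_piece (W i) (F i) (E i)" "\<And>i. Q i (F i) (E i)" "\<And>i. y \<notin> E i"
    "closedin Y (insert y (\<Union>i. E i))" "countable (insert y (\<Union>i. E i))"
    "\<And>i. f ` (\<Union>i. F i) \<inter> E i = f ` F i"
proof -
  \<comment> \<open>In a state \<open>(F, E, C)\<close>, the set \<open>C\<close> records
    \<open>y\<close>, the current \<open>E\<close> and, through \<open>R\<close>, all earlier ones;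
    the recursion starts from \<open>{y}\<close>.\<close>
  define P where "P i = (\<lambda>(F, E, C). isolated_piece (W i) F E \<and> Q i F E \<and> y \<notin> E \<and>
    closedin Y C \<and> countable C \<and> y \<in> C \<and> E \<subseteq> C)" for i
  define R where "R = (\<lambda>(F::'a set, E::'b set, C) (F'::'a set, E', C'::'b set). C \<subseteq> C' \<and> E' \<inter> C = {})"
  have step: "\<exists>F E C'. P i (F, E, C') \<and> C \<subseteq> C' \<and> E \<inter> C = {}"
    if C: "closedin Y C" "countable C" "y \<in> C" for i C
  proof -
    let ?U = "W i - {x \<in> topspace X. f x \<in> C}"
    obtain F E where FE: "isolated_piece ?U F E" "Q i F E"
      using abundantD[OF Q open_diff_preimage_nonempty[OF W C(1,2)]] by blast
    have "E \<inter> C = {}"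
      using FE(1) openin_subset[OF W(1)[of i]] by (auto simp: isolated_piece_def)
    moreover have "isolated_piece (W i) F E" using FE(1) by (auto simp: isolated_piece_def)
    ultimately have "P i (F, E, C \<union> E)"
      using FE(2) C by (auto simp: P_def isolated_piece_def)
    with \<open>E \<inter> C = {}\<close> show ?thesis by blast
  qed
  have "\<exists>g. \<forall>n. P n (g n) \<and> R (g n) (g (Suc n))"
  proof (rule dependent_nat_choice)
    show "\<exists>p. P 0 p"
      using step[of "{y}" 0] y HausdorffY by (auto simp: closedin_Hausdorff_singleton)
    show "\<exists>p'. P (Suc n) p' \<and> R p p'" if "P n p" for p n
    proof -
      obtain F E C where p: "p = (F, E, C)" by (cases p)
      then show ?thesis using step[of C "Suc n"] that by (auto simp: P_def R_def)
    qed
  qed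
  then obtain g where g: "\<And>n. P n (g n)" "\<And>n. R (g n) (g (Suc n))" by blast
  define F E C where "F n = fst (g n)" and "E n = fst (snd (g n))" and "C n = snd (snd (g n))" for n
  have gn: "g n = (F n, E n, C n)" for n by (simp add: F_def E_def C_def)
  have piece: "isolated_piece (W i) (F i) (E i)" "Q i (F i) (E i)" "y \<notin> E i" "E i \<subseteq> C i" for i
    using g(1)[of i] by (auto simp: P_def gn)
  have R: "C i \<subseteq> C (Suc i)" "E (Suc i) \<inter> C i = {}" for i
    using g(2)[of i] by (auto simp: R_def gn)
  have lt: "E i \<inter> E j = {}" if ij: "i < j" for i j
  proof -
    obtain k where k: "j = Suc k" "i \<le> k" using ij by (cases j) auto
    have "C i \<subseteq> C k" by (rule lift_Suc_mono_le[of C, OF R(1) k(2)])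
    then show ?thesis using piece(4)[of i] R(2)[of k] k by blast
  qed
  then have disj: "E i \<inter> E j = {}" if "i \<noteq> j" for i j
    using that by (metis Int_commute linorder_neqE_nat)
  show ?thesis
  proof
    have clE: "closedin Y (E i)" "countable (E i)" "E i \<subseteq> f ` W i" "f ` F i \<subseteq> E i" for i
      using piece(1)[of i] by (auto simp: isolated_piece_def)
    show "closedin Y (insert y (\<Union>i. E i))"
      using closedin_insert_Union_converging[OF HausdorffY y clE(1)] shrinks_to_subset[OF conv clE(3)] .
    show "countable (insert y (\<Union>i. E i))" using clE(2) by auto
    show "f ` (\<Union>i. F i) \<inter> E i = f ` F i" for i
    proof
      show "f ` (\<Union>i. F i) \<inter> E i \<subseteq> f ` F i"
      proof
        fix p assume p: "p \<in> f ` (\<Union>i. F i) \<inter> E i"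
        then obtain j where j: "p \<in> f ` F j" by auto
        then have "p \<in> E j" using clE(4) by blast
        then have "j = i" using disj[of j i] p by blast
        then show "p \<in> f ` F i" using j by simp
      qed
    qed (use clE(4) in auto)
  qed (use piece in auto)
qed

section \<open>Pieces with long alternation, by induction on the length\<close>

definition alternating_piece :: "nat \<Rightarrow> 'a set \<Rightarrow> 'b set \<Rightarrow> bool" where
  "alternating_piece n F E \<longleftrightarrow> (\<forall>A. A \<inter> E = f ` F \<longrightarrow> alternation Y A n \<inter> f ` F \<noteq> {})"

definition missed_limit_piece :: "nat \<Rightarrow> 'a set \<Rightarrow> 'b set \<Rightarrow> bool" where
  "missed_limit_piece n F E \<longleftrightarrow>
    (\<exists>y\<in>E - f ` F. \<forall>A. A \<inter> E = f ` F \<longrightarrow> y \<in> Y closure_of (alternation Y A n))"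

lemma abundant_alternating_piece_0: "abundant (alternating_piece 0)"
proof (rule abundantI)
  fix U assume assms: "openin X U" "U \<noteq> {}"
  obtain x where x: "x \<in> U" using assms by blast
  then have "x \<in> topspace X" using assms openin_subset by blast
  then have "isolated_piece U {x} {f x}" "alternating_piece 0 {x} {f x}"
    using x f_in metrizable_imp_Hausdorff_space[OF metrX] HausdorffY
    by (auto simp: isolated_piece_def alternating_piece_def closedin_Hausdorff_singleton)
  then show "\<exists>F E. isolated_piece U F E \<and> alternating_piece 0 F E" by blast
qed

lemma abundant_missed_limit_piece:
  assumes IH: "abundant (alternating_piece n)"
  shows "abundant (missed_limit_piece n)"
proof (rule abundantI)
  fix V assume V: "openin X V" "V \<noteq> {}"
  obtain y and W :: "nat \<Rightarrow> 'a set" where yV: "y \<in> f ` V"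
    and W: "\<And>i. openin X (W i)" "\<And>i. W i \<noteq> {}" "\<And>i. W i \<subseteq> V"
    and conv: "shrinks_to Y (\<lambda>i. f ` W i) y"
    and clos: "\<And>F. (\<And>i. closedin X (F i)) \<Longrightarrow> (\<And>i. F i \<subseteq> W i) \<Longrightarrow> closedin X (\<Union>i. F i)"
    by (rule obtain_locally_finite_converging[OF V]) (rule that; iprover)
  have y: "y \<in> topspace Y" using yV V openin_subset f_in by blast
  obtain F E where FE: "\<And>i. isolated_piece (W i) (F i) (E i)" "\<And>i. alternating_piece n (F i) (E i)"
    "\<And>i. y \<notin> E i" "closedin Y (insert y (\<Union>i. E i))" "countable (insert y (\<Union>i. E i))"
    "\<And>i. f ` (\<Union>i. F i) \<inter> E i = f ` F i"
    by (rule obtain_disjoint_pieces[OF W(1,2) IH y conv]) (rule that; iprover)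
  have piece: "closedin X (F i)" "F i \<subseteq> W i" "f ` F i \<subseteq> E i" "E i \<subseteq> f ` W i" for i
    using FE(1)[of i] by (auto simp: isolated_piece_def)
  \<comment> \<open>The limit \<open>y\<close> enters only \<open>?E\<close>: local finiteness
    closes \<open>?F\<close> without a point over \<open>y\<close>.\<close>
  let ?F = "\<Union>i. F i" and ?E = "insert y (\<Union>i. E i)"
  have "closedin X ?F" using clos piece by blast
  moreover have "?F \<subseteq> V" using piece(2) W(3) by blast
  moreover have "f ` ?F \<subseteq> ?E" using piece(3) by blast
  moreover have "?E \<subseteq> f ` V" using yV piece(4) W(3) by blast
  ultimately have "isolated_piece V ?F ?E"
    using FE(4,5) by (simp add: isolated_piece_def)
  moreover have "missed_limit_piece n ?F ?E"
    unfolding missed_limit_piece_def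
  proof (intro bexI[of _ y] allI impI)
    show "y \<in> ?E - f ` ?F" using piece(3) FE(3) by blast
    fix A assume A: "A \<inter> ?E = f ` ?F"
    have meets: "alternation Y A n \<inter> f ` F i \<noteq> {}" for i
    proof -
      have "A \<inter> E i = A \<inter> ?E \<inter> E i" by auto
      then have "A \<inter> E i = f ` F i" using A FE(6) by simp
      then show ?thesis using FE(2)[of i] by (simp add: alternating_piece_def)
    qed
    show "y \<in> Y closure_of (alternation Y A n)"
      unfolding in_closure_of
    proof (intro conjI allI impI y)
      fix N assume N: "y \<in> N \<and> openin Y N"
      obtain i where "f ` W i \<subseteq> N"
        by (rule shrinks_toE[OF conv conjunct2[OF N] conjunct1[OF N]])
      then show "\<exists>z. z \<in> alternation Y A n \<and> z \<in> N"
        using meets[of i] piece(2)[of i] by blast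
    qed
  qed
  ultimately show "\<exists>F E. isolated_piece V F E \<and> missed_limit_piece n F E" by blast
qed

lemma abundant_alternating_piece_Suc:
  assumes IH: "abundant (missed_limit_piece n)"
  shows "abundant (alternating_piece (Suc n))"
proof (rule abundantI)
  fix U assume U: "openin X U" "U \<noteq> {}"
  obtain x where xU: "x \<in> U" using U by blast
  then have x: "x \<in> topspace X" using U openin_subset by blast
  obtain B :: "nat \<Rightarrow> 'a set" where B: "\<And>n. openin X (B n)" "\<And>n. x \<in> B n"
    "shrinks_to X B x"
    by (rule metrizable_decreasing_neighbourhood_base[OF metrX x]) (rule that; iprover)
  define W where "W i = U \<inter> B i" for i
  have W: "openin X (W i)" "W i \<noteq> {}" for i
    using U B xU by (auto simp: W_def)
  have shrinkW: "shrinks_to X W x"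
    by (rule shrinks_to_subset[OF B(3)]) (auto simp: W_def)
  have conv: "shrinks_to Y (\<lambda>i. f ` W i) (f x)"
    by (rule shrinks_to_image[OF shrinkW cont x])
  obtain F E where FE: "\<And>i. isolated_piece (W i) (F i) (E i)" "\<And>i. missed_limit_piece n (F i) (E i)"
    "\<And>i. f x \<notin> E i" "closedin Y (insert (f x) (\<Union>i. E i))" "countable (insert (f x) (\<Union>i. E i))"
    "\<And>i. f ` (\<Union>i. F i) \<inter> E i = f ` F i"
    by (rule obtain_disjoint_pieces[OF W IH f_in[OF x] conv]) (rule that; iprover)
  have piece: "closedin X (F i)" "F i \<subseteq> W i" "f ` F i \<subseteq> E i" "E i \<subseteq> f ` W i" for i
    using FE(1)[of i] by (auto simp: isolated_piece_def)
  \<comment> \<open>Here the limit point \<open>x\<close> does enter \<open>?F\<close>, which both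
    closes it and puts \<open>f x\<close> into every admissible \<open>A\<close>.\<close>
  let ?F = "insert x (\<Union>i. F i)" and ?E = "insert (f x) (\<Union>i. E i)"
  have "closedin X ?F"
    by (rule closedin_insert_Union_converging[OF metrizable_imp_Hausdorff_space[OF metrX] x piece(1)
          shrinks_to_subset[OF shrinkW piece(2)]])
  moreover have "?F \<subseteq> U" using piece(2) xU by (auto simp: W_def)
  moreover have "f ` ?F \<subseteq> ?E" using piece(3) by blast
  moreover have "?E \<subseteq> f ` U" using xU piece(4) by (auto simp: W_def)
  ultimately have "isolated_piece U ?F ?E"
    using FE(4,5) by (simp add: isolated_piece_def)
  moreover have "alternating_piece (Suc n) ?F ?E"
    unfolding alternating_piece_def
  proof (intro allI impI)
    fix A assume A: "A \<inter> ?E = f ` ?F"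
    \<comment> \<open>Since \<open>f x \<notin> E i\<close>, inserting \<open>x\<close> leaves the
      trace on \<open>E i\<close> unchanged, so \<open>A\<close> is admissible for each single
      piece.\<close>
    have AE: "A \<inter> E i = f ` F i" for i
    proof -
      have "A \<inter> E i = A \<inter> ?E \<inter> E i" by auto
      also have "\<dots> = f ` (\<Union>i. F i) \<inter> E i" using A FE(3)[of i] by auto
      finally show ?thesis using FE(6) by simp
    qed
    have "f x \<in> Y closure_of (Y closure_of (alternation Y A n) - A)"
      unfolding in_closure_of[of "f x"]
    proof (intro conjI allI impI f_in[OF x])
      fix N assume N: "f x \<in> N \<and> openin Y N"
      obtain i where i: "f ` W i \<subseteq> N"
        by (rule shrinks_toE[OF conv conjunct2[OF N] conjunct1[OF N]])
      obtain y where y: "y \<in> E i - f ` F i" "y \<in> Y closure_of (alternation Y A n)"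
        using FE(2)[of i] AE[of i] by (auto simp: missed_limit_piece_def)
      then have "y \<notin> A" "y \<in> N" using AE[of i] piece(4)[of i] i by blast+
      with y show "\<exists>z. z \<in> Y closure_of (alternation Y A n) - A \<and> z \<in> N" by blast
    qed
    moreover have "f x \<in> A" using A by blast
    ultimately have "f x \<in> alternation Y A (Suc n) \<inter> f ` ?F" by simp
    then show "alternation Y A (Suc n) \<inter> f ` ?F \<noteq> {}" by blast
  qed
  ultimately show "\<exists>F E. isolated_piece U F E \<and> alternating_piece (Suc n) F E" by blast
qed

lemma abundant_alternating_piece: "abundant (alternating_piece n)"
proof (induction n)
  case 0
  show ?case by (rule abundant_alternating_piece_0)
next
  case (Suc n)
  then show ?case by (intro abundant_alternating_piece_Suc abundant_missed_limit_piece)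
qed

lemma topspace_empty: "topspace X = {}"
proof (rule ccontr)
  assume ne: "topspace X \<noteq> {}"
  obtain y and W :: "nat \<Rightarrow> 'a set" where yX: "y \<in> f ` topspace X"
    and W: "\<And>i. openin X (W i)" "\<And>i. W i \<noteq> {}" "\<And>i. W i \<subseteq> topspace X"
    and conv: "shrinks_to Y (\<lambda>i. f ` W i) y"
    and clos: "\<And>F. (\<And>i. closedin X (F i)) \<Longrightarrow> (\<And>i. F i \<subseteq> W i) \<Longrightarrow> closedin X (\<Union>i. F i)"
    by (rule obtain_locally_finite_converging[OF openin_topspace ne]) (rule that; iprover)
  have y: "y \<in> topspace Y" using yX f_in by blast
  \<comment> \<open>The i-th piece has alternation of order \<open>i\<close>, so no single order
    bounds the union.\<close>
  obtain F E where FE: "\<And>i. isolated_piece (W i) (F i) (E i)" "\<And>i. alternating_piece i (F i) (E i)"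
    "\<And>i. y \<notin> E i" "closedin Y (insert y (\<Union>i. E i))" "countable (insert y (\<Union>i. E i))"
    "\<And>i. f ` (\<Union>i. F i) \<inter> E i = f ` F i"
    by (rule obtain_disjoint_pieces[OF W(1,2) abundant_alternating_piece y conv]) (rule that; iprover)
  have "closedin X (\<Union>i. F i)"
    using FE(1) by (intro clos) (auto simp: isolated_piece_def)
  then have "constructible_in Y (f ` (\<Union>i. F i))"
    using constr by (simp add: closed_constructible_def)
  then obtain n where "alternation Y (f ` (\<Union>i. F i)) n = {}"
    by (rule constructible_in_alternation_empty)
  moreover have "alternation Y (f ` (\<Union>i. F i)) n \<noteq> {}"
    using FE(2)[of n] FE(6)[of n] unfolding alternating_piece_def by blast
  ultimately show False by blast
qed

end

section \<open>Reduction to the complement of the largest good open set\<close>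

theorem theorem1:
  fixes X :: "'a topology" and Y :: "'b topology" and f :: "'a \<Rightarrow> 'b"
  assumes "metrizable_space X" and "separable_space X"
    and "metrizable_space Y" and "separable_space Y"
    and "continuous_map X Y f"
    and "f ` topspace X = topspace Y"
    and "closed_constructible X Y f"
  shows "piecewise_closed X Y f"
proof -
  define \<U> where "\<U> = {U. openin X U \<and> piecewise_closed_on X Y f U}"
  have opn: "openin X (\<Union>\<U>)" by (auto simp: \<U>_def)
  have "Lindelof_space (subtopology X (\<Union>\<U>))"
    using assms(1,2) by (intro second_countable_imp_Lindelof_space second_countable_subtopology
        metrizable_separable_imp_second_countable)
  moreover have "topspace (subtopology X (\<Union>\<U>)) = \<Union>\<U>"
    using openin_subset[OF opn] by (simp add: inf.absorb2)
  moreover have "openin (subtopology X (\<Union>\<U>)) U" if "U \<in> \<U>" for U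
    using that opn by (auto simp: openin_open_subtopology \<U>_def)
  ultimately obtain \<V> where \<V>: "countable \<V>" "\<V> \<subseteq> \<U>" "\<Union>\<V> = \<Union>\<U>"
    using Lindelof_spaceD[of "subtopology X (\<Union>\<U>)" \<U>] by auto
  have good: "piecewise_closed_on X Y f (\<Union>\<U>)"
    using piecewise_closed_on_Union[OF \<V>(1), of X Y f] \<V>(2,3) by (auto simp: \<U>_def)
  define T where "T = topspace X - \<Union>\<U>"
  have T: "closedin X T" using opn by (auto simp: T_def)
  interpret nowhere_piecewise_closed "subtopology X T" Y f
  proof
    show "metrizable_space (subtopology X T)" "metrizable_space Y"
      using assms metrizable_space_subtopology by auto
    show "continuous_map (subtopology X T) Y f"
      using assms(5) continuous_map_from_subtopology by blast
    show "closed_constructible (subtopology X T) Y f"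
      using assms(7) T by (simp add: closed_constructible_def closedin_closed_subtopology)
    fix W assume W: "openin (subtopology X T) W" "W \<noteq> {}"
    show "\<not> piecewise_closed_on (subtopology X T) Y f W"
    proof
      assume "piecewise_closed_on (subtopology X T) Y f W"
      then have gW: "piecewise_closed_on X Y f (\<Union>\<U> \<union> W)"
        using T good piecewise_closed_on_Un piecewise_closed_on_subtopologyD by blast
      obtain O' where O': "openin X O'" "W = O' \<inter> T"
        using W(1) by (auto simp: openin_subtopology)
      \<comment> \<open>\<open>W\<close> is only relatively open in \<open>T\<close>, but its union
        with the largest good open set is open in \<open>X\<close>, which contradicts
        maximality.\<close>
      have "\<Union>\<U> \<union> W = \<Union>\<U> \<union> O'"
        using O' openin_subset[OF O'(1)] by (auto simp: T_def)
      then have "\<Union>\<U> \<union> O' \<in> \<U>" using gW opn O'(1) by (auto simp: \<U>_def)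
      then show False using W(2) O'(2) by (auto simp: T_def)
    qed
  qed
  have "T = {}" using topspace_empty closedin_subset[OF T] by (simp add: inf.absorb2)
  then have "\<Union>\<U> = topspace X" using openin_subset[OF opn] by (auto simp: T_def)
  then show ?thesis using good piecewise_closed_on_topspace by metis
qed

end
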